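(* Let $c$ be a constant with $0<c<\mathrm{e}^{-1/2}$, and let $G$ be a finite group with at least $$c\,|G/G'|\,\frac{(|G|!)^2}{|G|^{|G|}}$$ complete mappings. If $|G|\geq\max\{280816,\,11\log(c^{-1})\}$, then $\mathrm{Alt}(G)\leq P_{\mathrm{comp}}(G)\cap P_{\mathrm{orth}}(G)$.
   Context: A complete mapping of a group $G$ is a permutation $f$ of the set $G$ such that $g\mapsto gf(g)$ is also a permutation of $G$. An orthomorphism of $G$ is a permutation $f$ of $G$ such that $g\mapsto g^{-1}f(g)$ is also a permutation of $G$. $P_{\mathrm{comp}}(G)$, respectively $P_{\mathrm{orth}}(G)$, is the subgroup of $\mathrm{Sym}(G)$ (the symmetric group on the underlying set of $G$) generated by all complete mappings, respectively all orthomorphisms, of $G$. $\mathrm{Alt}(G)$ is the subgroup of even permutations in $\mathrm{Sym}(G)$. $G'$ is the commutator subgroup of $G$, and $\log$ is the natural logarithm. *)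

theory Defs
  imports Complex_Main "HOL-Combinatorics.Permutations" "HOL-Algebra.Generated_Groups"
begin

text \<open>
  As in the library's \<^const>\<open>permutes\<close>, a permutation of a set \<open>S\<close> is a function on the whole
  type that is the identity outside \<open>S\<close>, so that each permutation of \<open>S\<close> is represented by exactly
  one function. \<open>BijGroup\<close> is not used, since its elements are undefined outside \<open>S\<close> and
  \<^const>\<open>evenperm\<close> is then meaningless for them.
\<close>

definition sym_on :: "'a set \<Rightarrow> ('a \<Rightarrow> 'a) monoid" where
  "sym_on S = \<lparr>carrier = {p. p permutes S}, mult = (\<circ>), one = id\<rparr>"

definition alt_on :: "'a set \<Rightarrow> ('a \<Rightarrow> 'a) set" where
  "alt_on S = {p. p permutes S \<and> evenperm p}"

lemma group_sym_on: "group (sym_on S)"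
proof (rule groupI)
  fix p assume "p \<in> carrier (sym_on S)"
  then show "\<exists>q\<in>carrier (sym_on S). q \<otimes>\<^bsub>sym_on S\<^esub> p = \<one>\<^bsub>sym_on S\<^esub>"
    by (auto simp: sym_on_def intro!: bexI[of _ "Hilbert_Choice.inv p"] permutes_inv permutes_inv_o)
qed (auto simp: sym_on_def permutes_id comp_assoc intro: permutes_compose)

definition complete_mapping :: "('a, 'b) monoid_scheme \<Rightarrow> ('a \<Rightarrow> 'a) \<Rightarrow> bool" where
  "complete_mapping G f \<longleftrightarrow>
     f permutes carrier G \<and> bij_betw (\<lambda>g. g \<otimes>\<^bsub>G\<^esub> f g) (carrier G) (carrier G)"

definition orthomorphism :: "('a, 'b) monoid_scheme \<Rightarrow> ('a \<Rightarrow> 'a) \<Rightarrow> bool" where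
  "orthomorphism G f \<longleftrightarrow>
     f permutes carrier G \<and> bij_betw (\<lambda>g. inv\<^bsub>G\<^esub> g \<otimes>\<^bsub>G\<^esub> f g) (carrier G) (carrier G)"

definition P_comp :: "('a, 'b) monoid_scheme \<Rightarrow> ('a \<Rightarrow> 'a) set" where
  "P_comp G = generate (sym_on (carrier G)) {f. complete_mapping G f}"

definition P_orth :: "('a, 'b) monoid_scheme \<Rightarrow> ('a \<Rightarrow> 'a) set" where
  "P_orth G = generate (sym_on (carrier G)) {f. orthomorphism G f}"

end

theory Submission
  imports Defs "HOL-Analysis.Harmonic_Numbers"
begin

text \<open>
  Let \<open>n\<close> be the order of \<open>G\<close>, let \<open>A\<close> be the set of complete mappings or of orthomorphisms, and
  let \<open>P\<close> be the group generated by \<open>A\<close>. The hypotheses give \<open>c \<ge> exp (- n / 11)\<close>, and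
  \<open>n! \<ge> (n / e)^n\<close>, so there are at least \<open>exp (- 12 n / 11) n!\<close> complete mappings. Since
  \<open>f \<mapsto> (\<lambda>g. g f(g))\<close> maps complete mappings injectively to orthomorphisms, there are at least as
  many orthomorphisms. Hence the index of \<open>P\<close> in the symmetric group is at most \<open>exp (12 n / 11)\<close>,
  and large subgroups of the symmetric group are scarce.

  Composing an element of \<open>A\<close> with a right translation gives an element of \<open>A\<close> again, so \<open>P\<close>
  contains all right translations and is transitive. Assume that \<open>P\<close> does not contain the
  alternating group.

  If \<open>P\<close> is primitive, Bochert's theorem (\<open>bochert_index_bound\<close>) says that its index is at least
  the factorial of \<open>\<lceil>n / 2\<rceil>\<close>, which is far more than \<open>exp (12 n / 11)\<close>.

  If \<open>P\<close> preserves a partition into \<open>k \<ge> 3\<close> blocks of size \<open>m \<ge> 2\<close>, it has at most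
  \<open>k! (m!)^k\<close> elements (\<open>card_block_preserving_le\<close>). The critical case is \<open>k = 3\<close>, where the
  index is roughly \<open>3^n\<close>, and this exceeds \<open>exp (12 n / 11)\<close> for large \<open>n\<close> because
  \<open>ln 3 > 12 / 11\<close> (\<open>block_system_count_small\<close>).

  Two blocks cannot be excluded by counting, as \<open>2^n < exp (12 n / 11)\<close>. But then the block of the
  identity is a subgroup \<open>H\<close> of index two whose cosets are permuted by every \<open>f \<in> A\<close>, so that \<open>f\<close>
  would induce a complete mapping or an orthomorphism of the group of order two. There is none
  (\<open>index_two_obstruction\<close>).
\<close>

section \<open>Permutation groups containing a three-cycle\<close>

lemma subgroup_sym_onD:
  assumes "subgroup P (sym_on S)"
  shows "p \<in> P \<Longrightarrow> p permutes S" "id \<in> P"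
    "p \<in> P \<Longrightarrow> q \<in> P \<Longrightarrow> p \<circ> q \<in> P"
    "p \<in> P \<Longrightarrow> Hilbert_Choice.inv p \<in> P"
proof -
  interpret group "sym_on S" by (rule group_sym_on)
  show perm: "p permutes S" if "p \<in> P" for p
    using subgroup.mem_carrier[OF assms that] by (simp add: sym_on_def)
  show "id \<in> P" using subgroup.one_closed[OF assms] by (simp add: sym_on_def)
  show "p \<circ> q \<in> P" if "p \<in> P" "q \<in> P"
    using subgroup.m_closed[OF assms that] by (simp add: sym_on_def)
  show "Hilbert_Choice.inv p \<in> P" if "p \<in> P"
  proof -
    have "inv\<^bsub>sym_on S\<^esub> p = Hilbert_Choice.inv p"
      using perm[OF that]
      by (intro inv_equality) (auto simp: sym_on_def permutes_inv permutes_inv_o)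
    then show ?thesis using subgroup.m_inv_closed[OF assms that] by simp
  qed
qed

text \<open>
  For distinct points this is the cycle \<open>x \<mapsto> y \<mapsto> z \<mapsto> x\<close>.
\<close>

definition three_cycle :: "'a \<Rightarrow> 'a \<Rightarrow> 'a \<Rightarrow> 'a \<Rightarrow> 'a" where
  "three_cycle x y z = Transposition.transpose x y \<circ> Transposition.transpose y z"

lemma three_cycle_rotate:
  "distinct [x, y, z] \<Longrightarrow> three_cycle x y z = three_cycle y z x"
  by (rule ext) (auto simp: three_cycle_def Transposition.transpose_def)

lemma inv_three_cycle: "Hilbert_Choice.inv (three_cycle x y z) = three_cycle z y x"
  by (rule inv_unique_comp) (auto simp: three_cycle_def fun_eq_iff Transposition.transpose_commute)

lemma conj_three_cycle:
  assumes "bij p"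
  shows "p \<circ> three_cycle x y z \<circ> Hilbert_Choice.inv p = three_cycle (p x) (p y) (p z)"
proof
  fix t
  obtain s where t: "t = p s" using bij_pointE[OF assms] by metis
  have "p a = p b \<longleftrightarrow> a = b" for a b using bij_is_inj[OF assms] by (simp add: inj_eq)
  then show "(p \<circ> three_cycle x y z \<circ> Hilbert_Choice.inv p) t = three_cycle (p x) (p y) (p z) t"
    using bij_is_inj[OF assms] unfolding t
    by (simp add: three_cycle_def Transposition.transpose_def)
qed

definition invariant_under :: "('a \<Rightarrow> 'a) set \<Rightarrow> ('a \<times> 'a) set \<Rightarrow> bool" where
  "invariant_under P r \<longleftrightarrow> (\<forall>p\<in>P. \<forall>x y. (x, y) \<in> r \<longrightarrow> (p x, p y) \<in> r)"

definition primitive_on :: "'a set \<Rightarrow> ('a \<Rightarrow> 'a) set \<Rightarrow> bool" where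
  "primitive_on S P \<longleftrightarrow>
     (\<forall>r. equiv S r \<and> invariant_under P r \<longrightarrow> r = Id_on S \<or> r = S \<times> S)"

text \<open>
  An even permutation is a product of pairs of transpositions. A pair with a common point is trivial
  or a three-cycle, and a disjoint pair is a product of two pairs with a common point, because
  \<open>(a b) (c d) = (a b) (b c) (b c) (c d)\<close>.
\<close>

lemma alt_on_subset_if_three_cycles:
  assumes P: "subgroup P (sym_on S)" and fin: "finite S"
    and cyc: "\<And>x y z. {x, y, z} \<subseteq> S \<Longrightarrow> distinct [x, y, z] \<Longrightarrow> three_cycle x y z \<in> P"
  shows "alt_on S \<subseteq> P"
proof -
  note D = subgroup_sym_onD[OF P]
  let ?t = "Transposition.transpose"
  have two: "?t a b \<circ> ?t c d \<in> P" if "{a, b, c, d} \<subseteq> S" "a \<noteq> b" "c \<noteq> d" for a b c d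
  proof -
    have meet: "?t x y \<circ> ?t y z \<in> P" if "{x, y, z} \<subseteq> S" "x \<noteq> y" "y \<noteq> z" for x y z
    proof (cases "x = z")
      case True
      then have "?t x y \<circ> ?t y z = id" by (simp add: Transposition.transpose_commute fun_eq_iff)
      then show ?thesis using D(2) by simp
    next
      case False
      then show ?thesis using cyc[of x y z] that by (simp add: three_cycle_def)
    qed
    show ?thesis
    proof (cases "b = c")
      case True
      then show ?thesis using meet[of a b d] that by simp
    next
      case False
      have "?t a b \<circ> ?t c d = (?t a b \<circ> ?t b c) \<circ> (?t b c \<circ> ?t c d)"
        by (simp add: fun_eq_iff)
      then show ?thesis using meet[of a b c] meet[of b c d] D(3) that False by simp
    qed
  qed
  \<comment> \<open>Odd permutations are handled together with even ones, so that the induction can add a single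
    transposition at a time.\<close>
  have "(evenperm p \<longrightarrow> p \<in> P) \<and>
    (\<not> evenperm p \<longrightarrow> (\<forall>a\<in>S. \<forall>b\<in>S. a \<noteq> b \<longrightarrow> ?t a b \<circ> p \<in> P))" if "p permutes S" for p
    using that fin
  proof (induction rule: permutes_induct)
    case id
    then show ?case using D(2) by (simp add: id_def)
  next
    case (swap a b p)
    have "permutation p" using swap fin permutation_permutes by blast
    then have parity: "evenperm (?t a b \<circ> p) \<longleftrightarrow> \<not> evenperm p"
      using swap by (simp add: evenperm_comp evenperm_swap permutation_swap_id)
    have "?t c d \<circ> (?t a b \<circ> p) \<in> P" if "evenperm p" "c \<in> S" "d \<in> S" "c \<noteq> d" for c d
      using D(3)[OF two[of c d a b], of p] swap that by (simp add: comp_assoc)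
    then show ?case using parity swap by blast
  qed
  then show ?thesis by (auto simp: alt_on_def)
qed

text \<open>
  This special case of Jordan's theorem rests on the relation \<open>r\<close> that holds between two points
  if they are equal or occur together in a three-cycle of \<open>P\<close>. Conjugating one three-cycle
  by another shows that \<open>r\<close> is transitive, and conjugating by any element of \<open>P\<close> shows that it is
  invariant. By primitivity any two points are related. The same conjugations then turn a three-cycle
  through \<open>x\<close> and \<open>y\<close> into the one that continues with a prescribed third point.
\<close>

lemma primitive_three_cycle_imp_alt:
  assumes P: "subgroup P (sym_on S)" and fin: "finite S" and prim: "primitive_on S P"
    and abc: "three_cycle a b c \<in> P" "{a, b, c} \<subseteq> S" "distinct [a, b, c]"
  shows "alt_on S \<subseteq> P"
proof -
  note D = subgroup_sym_onD[OF P]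
  define C where "C x y z \<longleftrightarrow> {x, y, z} \<subseteq> S \<and> distinct [x, y, z] \<and> three_cycle x y z \<in> P"
    for x y z
  have conj: "C (p x) (p y) (p z)" if "C x y z" "p \<in> P" for p x y z
  proof -
    have bij: "bij p" and im: "p t \<in> S \<longleftrightarrow> t \<in> S" for t
      using D(1)[OF that(2)] by (auto simp: permutes_bij permutes_in_image)
    have "three_cycle (p x) (p y) (p z) \<in> P"
      using conj_three_cycle[OF bij, of x y z] D(3)[OF D(3)[OF that(2)] D(4)[OF that(2)]] that(1)
      by (metis C_def)
    then show ?thesis using that(1) im bij_is_inj[OF bij] by (auto simp: C_def inj_eq)
  qed
  have rot: "C y z x" if "C x y z" for x y z
    using that three_cycle_rotate[of x y z] by (auto simp: C_def)
  have rev: "C z y x" if "C x y z" for x y z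
    using that D(4)[of "three_cycle x y z"] by (auto simp: C_def inv_three_cycle)
  have app: "three_cycle x y z x = y" "three_cycle x y z y = z" "three_cycle x y z z = x"
    "t \<noteq> x \<Longrightarrow> t \<noteq> y \<Longrightarrow> t \<noteq> z \<Longrightarrow> three_cycle x y z t = t" if "C x y z" for x y z t
    using that by (auto simp: C_def three_cycle_def Transposition.transpose_def)
  define r where "r = {(x, y). x \<in> S \<and> y \<in> S \<and> (x = y \<or> (\<exists>z. C x y z))}"
  have "trans r"
  proof (rule transI)
    fix x y w assume "(x, y) \<in> r" "(y, w) \<in> r"
    \<comment> \<open>The conjugate of \<open>(x y z)\<close> by \<open>(y w u)\<close> sends \<open>y\<close> to \<open>w\<close> and keeps \<open>x\<close>, unless \<open>x\<close> lies
      on the second cycle, in which case that cycle already contains \<open>x\<close> and \<open>w\<close>.\<close>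
    moreover have "\<exists>v. C x w v" if xyz: "C x y z" and ywu: "C y w u" and "x \<noteq> w" for z u
    proof (cases "x = u")
      case True
      then show ?thesis using rev[OF ywu] by blast
    next
      case False
      let ?b = "three_cycle y w u"
      have "?b \<in> P" using ywu by (simp add: C_def)
      then have "C (?b x) (?b y) (?b z)" by (rule conj[OF xyz])
      moreover have "?b x = x" using app(4)[OF ywu] False \<open>x \<noteq> w\<close> xyz by (simp add: C_def)
      ultimately show ?thesis using app(1)[OF ywu] by auto
    qed
    ultimately show "(x, w) \<in> r" by (auto simp: r_def)
  qed
  moreover have "sym r" using rev rot unfolding r_def sym_def by blast
  moreover have "refl_on S r" "r \<subseteq> S \<times> S" by (auto simp: refl_on_def r_def)
  ultimately have "equiv S r" by (auto simp: equiv_def)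
  moreover have "invariant_under P r"
    unfolding invariant_under_def
  proof (intro ballI allI impI)
    fix p x y assume "p \<in> P" "(x, y) \<in> r"
    then show "(p x, p y) \<in> r"
      using conj[OF _ \<open>p \<in> P\<close>] permutes_in_image[OF D(1)[OF \<open>p \<in> P\<close>]]
      unfolding r_def by blast
  qed
  moreover have "(a, b) \<in> r" using abc by (auto simp: r_def C_def)
  then have "r \<noteq> Id_on S" using abc by auto
  ultimately have "r = S \<times> S" using prim unfolding primitive_on_def by blast
  then have link: "\<exists>z. C x y z" if "x \<in> S" "y \<in> S" "x \<noteq> y" for x y
  proof -
    have "(x, y) \<in> r" using \<open>r = S \<times> S\<close> that by simp
    then show ?thesis using that by (auto simp: r_def)
  qed
  have "three_cycle x y w \<in> P" if S: "{x, y, w} \<subseteq> S" and dist: "distinct [x, y, w]" for x y w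
  proof -
    obtain z where xyz: "C x y z" using link[of x y] S dist by auto
    have aP: "three_cycle x y z \<in> P" using xyz by (simp add: C_def)
    have ne: "x \<noteq> y" "x \<noteq> z" "y \<noteq> z" "z \<in> S" using xyz by (auto simp: C_def)
    have "C x y w"
    proof (cases "z = w")
      case True
      then show ?thesis using xyz by simp
    next
      case False
      then obtain u where zwu: "C z w u" using link[of z w] ne S by auto
      have bP: "three_cycle z w u \<in> P" using zwu by (simp add: C_def)
      note A = app[OF xyz] and B = app[OF zwu]
      \<comment> \<open>If \<open>u\<close> is new, conjugating by \<open>(z w u)\<close> replaces \<open>z\<close> by \<open>w\<close> in \<open>(x y z)\<close>. Otherwise both
        cycles live on \<open>{x, y, z, w}\<close>, and a conjugate of \<open>(z w u)\<close> by \<open>(x y z)\<close> or its inverse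
        is the desired cycle up to rotation and inversion.\<close>
      consider "u = x" | "u = y" | "u \<noteq> x" "u \<noteq> y" by blast
      then show ?thesis
      proof cases
        case 1
        have "three_cycle x y z w = w" using A(4)[of w] dist False by auto
        then have "C x w y" using conj[OF zwu aP] A(1-3) 1 by simp
        then show ?thesis using rev rot by blast
      next
        case 2
        let ?a' = "Hilbert_Choice.inv (three_cycle x y z)"
        have "bij (three_cycle x y z)" using D(1)[OF aP] permutes_bij by blast
        then have inv: "?a' t = s \<longleftrightarrow> t = three_cycle x y z s" for t s
          using bij_inv_eq_iff by metis
        have "three_cycle x y z w = w" using A(4)[of w] dist False by auto
        then have "?a' z = y" "?a' w = w" "?a' u = x"
          unfolding inv 2 using A(1,2) by simp_all
        then have "C y w x" using conj[OF zwu D(4)[OF aP]] by simp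
        then show ?thesis using rot by blast
      next
        case 3
        have "three_cycle z w u x = x" "three_cycle z w u y = y"
          using B(4)[of x] B(4)[of y] 3 ne dist by auto
        then show ?thesis using conj[OF xyz bP] B(1) by simp
      qed
    qed
    then show ?thesis by (simp add: C_def)
  qed
  then show ?thesis by (rule alt_on_subset_if_three_cycles[OF P fin])
qed

text \<open>
  If two permutations move only one common point \<open>a\<close>, they commute at all points but \<open>a\<close>
  and its preimages, so their commutator can move only \<open>a\<close>, \<open>g a\<close> and \<open>h a\<close>.
\<close>

lemma commutator_is_three_cycle:
  assumes "bij g" "bij h" and common: "\<And>t. g t \<noteq> t \<and> h t \<noteq> t \<longleftrightarrow> t = a"
  shows "g \<circ> h \<circ> Hilbert_Choice.inv g \<circ> Hilbert_Choice.inv h = three_cycle a (g a) (h a)"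
    (is "?c = ?d") and "distinct [a, g a, h a]"
proof -
  have ginj: "g x = g y \<longleftrightarrow> x = y" and hinj: "h x = h y \<longleftrightarrow> x = y" for x y
    using assms by (auto simp: bij_is_inj inj_eq)
  have a: "g a \<noteq> a" "h a \<noteq> a" using common by auto
  have ga: "g (h a) = h a" "h (g a) = g a" using common[of "h a"] common[of "g a"] a ginj hinj by auto
  show dist: "distinct [a, g a, h a]" using a ga ginj hinj by auto
  have D: "three_cycle a (g a) (h a) a = g a" "three_cycle a (g a) (h a) (g a) = h a"
    "three_cycle a (g a) (h a) (h a) = a"
    "\<And>t. t \<noteq> a \<Longrightarrow> t \<noteq> g a \<Longrightarrow> t \<noteq> h a \<Longrightarrow> three_cycle a (g a) (h a) t = t"
    using dist by (auto simp: three_cycle_def Transposition.transpose_def)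
  \<comment> \<open>The claim about the commutator, evaluated at \<open>h (g t)\<close> so that no inverse occurs.\<close>
  have main: "g (h t) = ?d (h (g t))" for t
  proof -
    consider "t = a" | "t \<noteq> a" "g t = a" | "t \<noteq> a" "h t = a"
      | "t \<noteq> a" "g t \<noteq> a" "h t \<noteq> a" by blast
    then show ?thesis
    proof cases
      case 1
      then show ?thesis using ga D by simp
    next
      case 2
      then have "h t = t" using common[of t] by auto
      then show ?thesis using 2 D by simp
    next
      case 3
      then have "g t = t" using common[of t] by auto
      then show ?thesis using 3 D by simp
    next
      case 4
      show ?thesis
      proof (cases "h t = t")
        case True
        then have "h (g t) = g t" using common[of "g t"] 4 ginj by (cases "g t = t") auto
        moreover have "g t \<noteq> h a \<and> g t \<noteq> g a"
          using True 4 ga ginj[of t "h a"] ginj[of t a] hinj[of t a] by auto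
        ultimately show ?thesis using True D(4)[of "g t"] 4 by simp
      next
        case False
        then have "g t = t" "g (h t) = h t" using common[of t] common[of "h t"] 4 hinj by auto
        moreover have "h t \<noteq> g a \<and> h t \<noteq> h a"
          using \<open>g t = t\<close> 4 ga hinj[of t "g a"] hinj[of t a] ginj[of t a] by auto
        ultimately show ?thesis using D(4)[of "h t"] 4 by simp
      qed
    qed
  qed
  show "?c = ?d"
  proof
    fix t
    obtain s where "t = h (g s)" using assms bij_pointE by metis
    then show "?c t = ?d t" using assms(1,2) main[of s] by (simp add: bij_is_inj)
  qed
qed

section \<open>Bochert's theorem\<close>

text \<open>
  Let \<open>B\<close> be a smallest set of points whose pointwise stabilizer in \<open>P\<close> is trivial. If \<open>B\<close> contained
  more than half of the points, its complement would be smaller, so some \<open>h \<noteq> id\<close> would move only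
  points of \<open>B\<close>; take \<open>a\<close> among them. By minimality some \<open>g \<noteq> id\<close> fixes \<open>B - {a}\<close> pointwise, and \<open>g\<close>
  must move \<open>a\<close>. Then \<open>a\<close> is the only point moved by both \<open>g\<close> and \<open>h\<close>, their commutator is a
  three-cycle, and \<open>P\<close> contains the alternating group. So \<open>B\<close> has at most half of the points. Since
  \<open>P\<close> meets the group of permutations fixing \<open>B\<close> pointwise only in the identity, products of elements
  of the two are all distinct, which gives the bound.
\<close>

lemma bochert_index_bound:
  assumes P: "subgroup P (sym_on S)" and fin: "finite S" and prim: "primitive_on S P"
    and no_alt: "\<not> alt_on S \<subseteq> P"
  shows "card P * fact (card S - card S div 2) \<le> fact (card S)"
proof -
  note D = subgroup_sym_onD[OF P]
  define base where "base B \<longleftrightarrow> B \<subseteq> S \<and> (\<forall>p\<in>P. (\<forall>x\<in>B. p x = x) \<longrightarrow> p = id)" for B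
  have "p = id" if "p \<in> P" "\<forall>x\<in>S. p x = x" for p
    using that permutes_not_in[OF D(1)[OF that(1)]] by (intro ext) (metis id_apply)
  then have "base S" by (simp add: base_def)
  then obtain B where B: "base B" and min: "\<And>C. base C \<Longrightarrow> card B \<le> card C"
    using ex_has_least_nat[of base S card] by blast
  have BS: "B \<subseteq> S" and trivial: "\<And>p. p \<in> P \<Longrightarrow> (\<And>x. x \<in> B \<Longrightarrow> p x = x) \<Longrightarrow> p = id"
    using B by (auto simp: base_def)
  have finB: "finite B" using BS fin by (rule finite_subset)
  have "2 * card B \<le> card S"
  proof (rule ccontr)
    assume "\<not> 2 * card B \<le> card S"
    then have "card (S - B) < card B" using BS fin finB by (simp add: card_Diff_subset)
    then have "\<not> base (S - B)" using min[of "S - B"] by auto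
    then obtain h where h: "h \<in> P" "\<And>x. x \<in> S \<Longrightarrow> x \<notin> B \<Longrightarrow> h x = x" "h \<noteq> id"
      unfolding base_def by auto
    then obtain a where a: "h a \<noteq> a" by (auto simp: fun_eq_iff)
    have aS: "a \<in> S" using a permutes_not_in[OF D(1)[OF h(1)]] by blast
    then have aB: "a \<in> B" using a h(2) by blast
    have "card (B - {a}) < card B" using finB aB by (rule card_Diff1_less)
    then have "\<not> base (B - {a})" using min[of "B - {a}"] by auto
    then obtain g where g: "g \<in> P" "\<And>x. x \<in> B \<Longrightarrow> x \<noteq> a \<Longrightarrow> g x = x" "g \<noteq> id"
      unfolding base_def using BS by auto
    have ga: "g a \<noteq> a" using trivial[OF g(1)] g(2,3) by metis
    have common: "g t \<noteq> t \<and> h t \<noteq> t \<longleftrightarrow> t = a" for t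
      using a ga g(2)[of t] h(2)[of t] permutes_not_in[OF D(1)[OF h(1)], of t] by metis
    have bij: "bij g" "bij h" using D(1) g h permutes_bij by blast+
    have "g \<circ> h \<circ> Hilbert_Choice.inv g \<circ> Hilbert_Choice.inv h \<in> P"
      by (intro D(3,4) g(1) h(1))
    then have "three_cycle a (g a) (h a) \<in> P"
      by (simp only: commutator_is_three_cycle(1)[OF bij common])
    moreover have "{a, g a, h a} \<subseteq> S"
      using aS permutes_in_image[OF D(1)[OF g(1)]] permutes_in_image[OF D(1)[OF h(1)]] by simp
    ultimately have "alt_on S \<subseteq> P"
      using commutator_is_three_cycle(2)[OF bij common]
      by (intro primitive_three_cycle_imp_alt[OF P fin prim])
    with no_alt show False by simp
  qed
  then have half: "card S - card S div 2 \<le> card (S - B)"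
    using BS finB by (simp add: card_Diff_subset)
  let ?K = "{q. q permutes (S - B)}"
  have "inj_on (\<lambda>(p, q). p \<circ> q) (P \<times> ?K)"
  proof (rule inj_onI, clarify)
    fix p q p' q' assume pq: "p \<in> P" "q permutes (S - B)" "p' \<in> P" "q' permutes (S - B)"
      and eq: "p \<circ> q = p' \<circ> q'"
    have surj: "surj p'" and inj: "inj p'" 
      using D(1)[OF pq(3)] by (simp_all add: permutes_surj permutes_inj)
    have "(Hilbert_Choice.inv p' \<circ> p) x = x" if "x \<in> B" for x
    proof -
      have "p x = p' x"
        using fun_cong[OF eq, of x] permutes_not_in[OF pq(2), of x] permutes_not_in[OF pq(4), of x] that
        by simp
      then show ?thesis using inj by simp
    qed
    then have "Hilbert_Choice.inv p' \<circ> p = id" by (intro trivial D(3,4) pq)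
    then have "p' \<circ> (Hilbert_Choice.inv p' \<circ> p) = p'" by simp
    then have "p = p'" using surj by (simp add: o_assoc surj_iff)
    moreover from this have "q = q'" using eq inj by (auto simp: fun_eq_iff inj_eq)
    ultimately show "p = p' \<and> q = q'" by simp
  qed
  moreover have "(\<lambda>(p, q). p \<circ> q) ` (P \<times> ?K) \<subseteq> {p. p permutes S}"
    using D(1) permutes_subset[of _ "S - B" S] by (auto intro!: permutes_compose)
  ultimately have "card (P \<times> ?K) \<le> card {p. p permutes S}"
    using finite_permutations[OF fin] by (rule card_inj_on_le)
  then have "card P * fact (card (S - B)) \<le> (fact (card S) :: nat)"
    using fin by (simp add: card_cartesian_product card_permutations)
  moreover have "(fact (card S - card S div 2) :: nat) \<le> fact (card (S - B))"
    using half by (rule fact_mono)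
  ultimately show ?thesis by (meson mult_le_mono2 order_trans)
qed

section \<open>Permutations preserving a block system\<close>

text \<open>
  Such a permutation is determined by its restrictions to the members of the partition.
\<close>

lemma card_stabilizer_of_sets_le:
  assumes fin: "finite S" and part: "\<Union>\<B> = S" and size: "\<And>B. B \<in> \<B> \<Longrightarrow> card B = m"
  shows "card {q. q permutes S \<and> (\<forall>B\<in>\<B>. q ` B = B)} \<le> fact m ^ card \<B>" (is "card ?K \<le> _")
proof -
  have finB: "finite B" if "B \<in> \<B>" for B
    using that part by (intro finite_subset[OF _ fin]) auto
  have "finite \<B>" using fin part by (intro finite_UnionD) simp
  define \<Psi> where "\<Psi> q = (\<lambda>B\<in>\<B>. \<lambda>x. if x \<in> B then q x else x)" for q :: "'a \<Rightarrow> 'a"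
  have "inj_on \<Psi> ?K"
  proof (rule inj_onI, rule ext)
    fix q q' x assume q: "q \<in> ?K" "q' \<in> ?K" "\<Psi> q = \<Psi> q'"
    show "q x = q' x"
    proof (cases "x \<in> S")
      case True
      then obtain B where B: "B \<in> \<B>" "x \<in> B" using part by auto
      from q(3) have "\<Psi> q B x = \<Psi> q' B x" by simp
      then show ?thesis using B by (simp add: \<Psi>_def)
    next
      case False
      then show ?thesis using q(1,2) permutes_not_in[of q S x] permutes_not_in[of q' S x] by simp
    qed
  qed
  moreover have "\<Psi> q \<in> (\<Pi>\<^sub>E B\<in>\<B>. {q. q permutes B})" if q: "q \<in> ?K" for q
  proof -
    have "(\<lambda>x. if x \<in> B then q x else x) permutes B" if B: "B \<in> \<B>" for B
    proof (rule bij_imp_permutes)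
      have "bij_betw q B B" using q B permutes_inj_on[of q S B] by (simp add: bij_betw_def)
      then show "bij_betw (\<lambda>x. if x \<in> B then q x else x) B B"
        by (rule bij_betw_cong[THEN iffD1, rotated]) simp
    qed simp
    then show ?thesis by (simp add: \<Psi>_def)
  qed
  then have "\<Psi> ` ?K \<subseteq> (\<Pi>\<^sub>E B\<in>\<B>. {q. q permutes B})" by (rule image_subsetI)
  moreover have "finite (\<Pi>\<^sub>E B\<in>\<B>. {q. q permutes B})"
    using finB \<open>finite \<B>\<close> by (intro finite_PiE finite_permutations) auto
  ultimately have "card ?K \<le> card (\<Pi>\<^sub>E B\<in>\<B>. {q. q permutes B})" by (rule card_inj_on_le)
  also have "\<dots> = (\<Prod>B\<in>\<B>. card {q. q permutes B})" using \<open>finite \<B>\<close> by (rule card_PiE)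
  also have "\<dots> = (\<Prod>B\<in>\<B>. fact m)"
    by (rule prod.cong) (simp_all add: card_permutations[OF size finB])
  finally show ?thesis by simp
qed

text \<open>
  A permutation preserving the equivalence relation permutes its classes. Two permutations that induce
  the same permutation of the classes differ by one that fixes every class, so each fiber is
  at most as large as the stabilizer bounded above.
\<close>

lemma card_block_preserving_le:
  assumes fin: "finite S" and r: "equiv S r" and size: "\<And>B. B \<in> S // r \<Longrightarrow> card B = m"
  shows "card {p. p permutes S \<and> invariant_under {p} r} \<le> fact (card (S // r)) * fact m ^ card (S // r)"
proof -
  define W where "W = {p. p permutes S \<and> invariant_under {p} r}"
  have W: "p permutes S" "(x, y) \<in> r \<Longrightarrow> (p x, p y) \<in> r" if "p \<in> W" for p x y
    using that by (auto simp: W_def invariant_under_def)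
  let ?B = "S // r"
  have finB: "finite ?B" using fin r by (simp add: equiv_type finite_quotient)
  have finB': "finite B" if "B \<in> ?B" for B
    using that Union_quotient[OF r] by (intro finite_subset[OF _ fin]) auto
  have im: "p ` B \<in> ?B" if p: "p \<in> W" and B: "B \<in> ?B" for p B
  proof -
    obtain x where x: "x \<in> S" "B = r `` {x}" using B by (auto elim: quotientE)
    have px: "p x \<in> S" using permutes_in_image[OF W(1)[OF p]] x by simp
    then have B': "r `` {p x} \<in> ?B" by (rule quotientI)
    have "p ` B \<subseteq> r `` {p x}" using W(2)[OF p] x by auto
    moreover have "inj_on p B" using permutes_inj_on[OF W(1)[OF p]] .
    then have "card (p ` B) = card (r `` {p x})"
      using size[OF B] size[OF B'] by (simp add: card_image)
    ultimately have "p ` B = r `` {p x}" using finB'[OF B'] by (simp add: card_subset_eq)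
    then show ?thesis using B' by simp
  qed
  define \<Phi> where "\<Phi> p = (\<lambda>B. if B \<in> ?B then p ` B else B)" for p :: "'a \<Rightarrow> 'a"
  have \<Phi>: "\<Phi> p permutes ?B" if "p \<in> W" for p
  proof (rule inj_imp_permutes)
    show "inj_on (\<Phi> p) ?B"
      using permutes_inj[OF W(1)[OF that]] by (intro inj_onI) (simp add: \<Phi>_def inj_image_eq_iff)
  qed (use that im finB in \<open>auto simp: \<Phi>_def\<close>)
  have fiber: "card {p \<in> W. \<Phi> p = \<sigma>} \<le> fact m ^ card ?B" for \<sigma>
  proof (cases "{p \<in> W. \<Phi> p = \<sigma>} = {}")
    case False
    then obtain p0 where p0: "p0 \<in> W" "\<Phi> p0 = \<sigma>" by auto
    let ?K = "{q. q permutes S \<and> (\<forall>B\<in>?B. q ` B = B)}"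
    let ?i = "Hilbert_Choice.inv p0"
    have bij: "bij p0" using permutes_bij[OF W(1)[OF p0(1)]] .
    have "inj_on ((\<circ>) ?i) {p \<in> W. \<Phi> p = \<sigma>}"
    proof (rule inj_onI)
      fix p q assume "?i \<circ> p = ?i \<circ> q"
      then have "p0 \<circ> (?i \<circ> p) = p0 \<circ> (?i \<circ> q)" by simp
      then show "p = q" using surj_iff[THEN iffD1, OF bij_is_surj[OF bij]] by (simp add: o_assoc)
    qed
    moreover have "(\<circ>) ?i ` {p \<in> W. \<Phi> p = \<sigma>} \<subseteq> ?K"
    proof
      fix q assume "q \<in> (\<circ>) ?i ` {p \<in> W. \<Phi> p = \<sigma>}"
      then obtain p where p: "p \<in> W" "\<Phi> p = \<sigma>" "q = ?i \<circ> p" by blast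
      have "q ` B = B" if B: "B \<in> ?B" for B
      proof -
        have "\<Phi> p B = \<Phi> p0 B" using p(2) p0(2) by simp
        then have "p ` B = p0 ` B" using B by (simp add: \<Phi>_def)
        then have "q ` B = ?i ` p0 ` B" unfolding p(3) image_comp[symmetric] by simp
        then show ?thesis using bij_is_inj[OF bij] by (simp only: image_inv_f_f)
      qed
      then show "q \<in> ?K" using permutes_compose[OF W(1)[OF p(1)] permutes_inv[OF W(1)[OF p0(1)]]] p(3) by simp
    qed
    moreover have "finite ?K" using finite_permutations[OF fin] by simp
    ultimately have "card {p \<in> W. \<Phi> p = \<sigma>} \<le> card ?K" by (rule card_inj_on_le)
    also have "\<dots> \<le> fact m ^ card ?B"
      using card_stabilizer_of_sets_le[OF fin Union_quotient[OF r]] size by blast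
    finally show ?thesis .
  next
    case True
    then show ?thesis by (metis card.empty le0)
  qed
  let ?T = "{\<sigma>. \<sigma> permutes ?B}"
  have finT: "finite ?T" using finB by (rule finite_permutations)
  have "W = (\<Union>\<sigma>\<in>?T. {p \<in> W. \<Phi> p = \<sigma>})"
  proof (rule Set.set_eqI)
    show "p \<in> W \<longleftrightarrow> p \<in> (\<Union>\<sigma>\<in>?T. {p \<in> W. \<Phi> p = \<sigma>})" for p using \<Phi>[of p] by auto
  qed
  then have "card W = card (\<Union>\<sigma>\<in>?T. {p \<in> W. \<Phi> p = \<sigma>})" by (rule arg_cong)
  also have "\<dots> \<le> (\<Sum>\<sigma>\<in>?T. card {p \<in> W. \<Phi> p = \<sigma>})" by (rule card_UN_le[OF finT])
  also have "\<dots> \<le> (\<Sum>\<sigma>\<in>?T. fact m ^ card ?B)" by (rule sum_mono) (rule fiber)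
  also have "\<dots> = card ?T * fact m ^ card ?B" by (simp only: sum_constant of_nat_id)
  finally show ?thesis unfolding W_def card_permutations[OF refl finB] .
qed

lemma transitive_block_sizes:
  assumes fin: "finite S" and r: "equiv S r"
    and perm: "\<And>p. p \<in> P \<Longrightarrow> p permutes S" and inv: "invariant_under P r"
    and trans: "\<And>x y. x \<in> S \<Longrightarrow> y \<in> S \<Longrightarrow> \<exists>p\<in>P. p x = y"
    and B: "B \<in> S // r" "C \<in> S // r"
  shows "card B = card C"
proof -
  have "card (r `` {x}) \<le> card (r `` {y})" if xy: "x \<in> S" "y \<in> S" for x y
  proof -
    obtain p where p: "p \<in> P" "p x = y" using trans xy by blast
    have "p ` (r `` {x}) \<subseteq> r `` {y}" using inv p by (auto simp: invariant_under_def)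
    moreover have "finite (r `` {y})"
      using equiv_type[OF r] by (intro finite_subset[OF _ fin]) auto
    ultimately show ?thesis using card_inj_on_le[OF permutes_inj_on[OF perm[OF p(1)]]] by blast
  qed
  then show ?thesis using B by (auto elim!: quotientE intro: antisym)
qed

section \<open>Estimates for factorials\<close>

text \<open>
  The term \<open>n^n / n!\<close> of the exponential series at \<open>n\<close> is at most \<open>exp n\<close>.
\<close>

lemma ln_fact_ge: "real n * ln (real n) - real n \<le> ln (fact n)"
proof (cases "n = 0")
  case False
  have "real n ^ n / fact n \<le> exp (real n)"
  proof -
    have "(\<lambda>k. real n ^ k /\<^sub>R fact k) sums exp (real n)" by (rule exp_converges)
    then have "(\<Sum>k\<in>{n}. real n ^ k /\<^sub>R fact k) \<le> exp (real n)"
      by (intro sum_le_suminf[of _ "{n}", THEN order_trans]) (auto simp: sums_iff)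
    then show ?thesis by (simp add: divide_inverse mult.commute)
  qed
  then have "ln (real n ^ n / fact n) \<le> real n"
    using False ln_mono[of "real n ^ n / fact n" "exp (real n)"] by simp
  then show ?thesis using False by (simp add: ln_div ln_realpow)
qed simp

text \<open>
  The induction step amounts to \<open>(1 + 1 / n)^(n + 1) \<ge> e\<close>.
\<close>

lemma ln_fact_le:
  assumes "n > 0"
  shows "ln (fact n) \<le> 1 + ln (real n) + real n * ln (real n) - real n"
  using assms
proof (induction n rule: nat_induct_non_zero)
  case (Suc n)
  have "ln (real n / real (Suc n)) \<le> real n / real (Suc n) - 1"
    using Suc by (intro ln_le_minus_one) simp
  also have "\<dots> = - (1 / (real n + 1))" by (simp add: field_simps)
  finally have "ln (real n) + 1 / (real n + 1) \<le> ln (real n + 1)"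
    using Suc by (simp add: ln_div algebra_simps)
  then have "(real n + 1) * (ln (real n) + 1 / (real n + 1)) \<le> (real n + 1) * ln (real n + 1)"
    by (intro mult_left_mono) simp_all
  then have "(real n + 1) * ln (real n) + 1 \<le> (real n + 1) * ln (real n + 1)"
    by (simp add: distrib_left)
  moreover have "ln (fact (Suc n)) = ln (real n + 1) + ln (fact n)"
    by (simp add: ln_mult add.commute)
  ultimately show ?case using Suc.IH by (simp add: algebra_simps)
qed simp

text \<open>
  The margin \<open>7 / 1000\<close> is nearly the best possible and is what allows three blocks to be excluded.
\<close>

lemma ln_3_gt: "12 / 11 + 7 / 1000 < ln (3::real)"
  using ln_approx_bounds[of 3 4] by (simp add: eval_nat_numeral)

text \<open>
  After taking logarithms and dividing by the number \<open>k\<close> of blocks, the count of block-preserving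
  permutations comes down to this. For many blocks \<open>ln k\<close> is well above \<open>12 / 11\<close> and any
  \<open>m \<ge> 2\<close> will do. For few blocks \<open>ln k\<close> may exceed \<open>12 / 11\<close> only by the small margin of
  \<open>ln 3\<close>, but then \<open>m\<close> is so large that this margin, multiplied by \<open>m\<close>, outweighs \<open>ln m\<close>.
\<close>

lemma block_size_inequality:
  fixes m k :: nat
  assumes m: "2 \<le> m" and k: "3 \<le> k" and large: "280816 \<le> m * k"
  shows "ln m + 1 + 12 / 11 * m < (real m - 1) * ln k"
proof (cases "k \<ge> 128")
  case True
  have "ln (2 ^ 7 :: real) \<le> ln k" using True by (subst ln_le_cancel_iff) simp_all
  then have "14 / 3 \<le> ln k" using ln2_ge_two_thirds ln_realpow[of 2 7] by simp
  then have "(real m - 1) * (14 / 3) \<le> (real m - 1) * ln k" using m by (intro mult_left_mono) simp_all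
  moreover have "ln m \<le> real m - 1" using m by (intro ln_le_minus_one) simp
  moreover have "2 \<le> real m" using m by simp
  ultimately have "ln m + 1 + 12 / 11 * m < (real m - 1) * (14 / 3)"
    by (simp add: field_simps)
  also note \<open>\<dots> \<le> (real m - 1) * ln k\<close>
  finally show ?thesis .
next
  case False
  have "m * k \<le> m * 128" using False by simp
  then have "280816 \<le> m * 128" using large by linarith
  then have m': "real m \<ge> 2193" by simp
  have "ln (3::real) \<le> ln k" using k by (subst ln_le_cancel_iff) simp_all
  then have "(real m - 1) * (12 / 11 + 7 / 1000) \<le> (real m - 1) * ln k"
    using ln_3_gt m by (intro mult_left_mono) simp_all
  \<comment> \<open>The tangent of the logarithm at 1024 bounds \<open>ln m\<close> by a linear function of slope below
    \<open>7 / 1000\<close>, and \<open>ln 1024 = 10 ln 2\<close> is easily estimated.\<close>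
  moreover have "ln (m / 1024) \<le> m / 1024 - 1" using m by (intro ln_le_minus_one) simp
  moreover have "ln (1024 :: real) \<le> 250 / 36"
    using ln2_le_25_over_36 ln_realpow[of 2 10] by simp
  ultimately have "ln m + 1 + 12 / 11 * m < (real m - 1) * (12 / 11 + 7 / 1000)"
    using m m' by (simp add: ln_div field_simps)
  also note \<open>\<dots> \<le> (real m - 1) * ln k\<close>
  finally show ?thesis .
qed

lemma block_system_count_small:
  fixes m k :: nat
  assumes m: "2 \<le> m" and k: "3 \<le> k" and large: "280816 \<le> m * k"
  shows "fact k * fact m ^ k < exp (- 12 / 11 * (m * k)) * (fact (m * k) :: real)"
proof -
  have pos: "m > 0" "k > 0" using m k by simp_all
  have lnk: "ln (real k) \<le> k - 1" using pos ln_le_minus_one[of "real k"] by (simp add: of_nat_diff)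
  have "ln (fact k * fact m ^ k :: real) = ln (fact k) + k * ln (fact m)"
    by (simp add: ln_mult ln_realpow)
  also have "\<dots> \<le> 1 + ln k + k * ln k - k + k * (1 + ln m + m * ln m - m)"
    using pos by (intro add_mono mult_left_mono ln_fact_le) simp_all
  also have "\<dots> \<le> k * (ln m + 1 + 12 / 11 * m + ln k) + (m * k * ln m - m * k - 12 / 11 * (m * k))"
    using lnk pos by (simp add: algebra_simps of_nat_diff)
  also have "\<dots> < k * ((real m - 1) * ln k + ln k) + (m * k * ln m - m * k - 12 / 11 * (m * k))"
    using block_size_inequality[OF assms] pos by simp
  also have "\<dots> = (m * k) * ln (m * k) - m * k - 12 / 11 * (m * k)"
    using pos by (simp add: algebra_simps of_nat_diff ln_mult)
  also have "\<dots> \<le> ln (fact (m * k)) - 12 / 11 * (m * k)"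
    using ln_fact_ge[of "m * k"] by (intro diff_right_mono) simp
  also have "\<dots> = ln (exp (- 12 / 11 * (m * k)) * fact (m * k))"
    by (simp add: ln_mult)
  finally show ?thesis by (subst (asm) ln_less_cancel_iff) simp_all
qed

lemma half_factorial_large:
  assumes "n \<ge> 280816"
  shows "exp (12 / 11 * real n) < fact (n - n div 2)"
proof -
  define h where "h = n - n div 2"
  have h: "real n \<le> 2 * real h" "real h \<ge> 1024" using assms by (auto simp: h_def)
  have "ln (1024 :: real) \<le> ln (real h)" using h by (subst ln_le_cancel_iff) simp_all
  then have "20 / 3 \<le> ln (real h)" using ln2_ge_two_thirds ln_realpow[of 2 10] by simp
  then have "real h * (20 / 3) \<le> real h * ln (real h)" by (rule mult_left_mono) simp
  then have "12 / 11 * real n < ln (fact h)" using ln_fact_ge[of h] h by linarith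
  then have "exp (12 / 11 * real n) < exp (ln (fact h))" by (simp only: exp_less_cancel_iff)
  then show ?thesis by (simp add: h_def)
qed

text \<open>
  The logarithmic assumption means \<open>c \<ge> exp (- n / 11)\<close>, and one of the two factorials in the lower bound
  is at least \<open>n^n exp (- n)\<close>.
\<close>

lemma exp_fact_le_if_count:
  fixes c q :: real and n :: nat
  assumes c: "0 < c" "11 * ln (inverse c) \<le> n" and q: "1 \<le> q" and n: "0 < n"
  shows "exp (- 12 / 11 * n) * fact n \<le> c * q * ((fact n)\<^sup>2 / real n ^ n)"
proof -
  have "exp (- real n / 11) \<le> exp (ln c)"
    using c by (subst exp_le_cancel_iff) (simp add: ln_inverse)
  then have c': "exp (- real n / 11) \<le> c" using c by simp
  have "exp (real n * ln n - n) \<le> exp (ln (fact n))" using ln_fact_ge by (subst exp_le_cancel_iff)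
  then have "real n ^ n * exp (- real n) \<le> fact n"
    using n by (simp add: exp_diff exp_minus exp_of_nat_mult divide_inverse)
  then have stirling: "exp (- real n) \<le> fact n / real n ^ n"
    using n by (simp add: pos_le_divide_eq mult.commute)
  have "exp (- 12 / 11 * real n) * fact n = exp (- real n / 11) * 1 * (exp (- real n) * fact n)"
    by (simp flip: exp_add mult.assoc)
  also have "\<dots> \<le> c * q * (fact n / real n ^ n * fact n)"
    using c' q stirling c by (intro mult_mono) simp_all
  finally show ?thesis by (simp add: power2_eq_square)
qed

section \<open>The obstruction from subgroups of index two\<close>

text \<open>
  Membership in \<open>H\<close> is the kernel condition of the homomorphism onto the group of order two. The index
  is used in the case \<open>x, y \<notin> H\<close>: then the coset of \<open>inv x\<close> is the whole complement of \<open>H\<close>, so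
  it contains \<open>y\<close>.
\<close>

lemma (in group) index_two_mult_iff:
  assumes H: "subgroup H G" and fin: "finite (carrier G)" and idx: "2 * card H = order G"
    and x: "x \<in> carrier G" and y: "y \<in> carrier G"
  shows "x \<otimes> y \<in> H \<longleftrightarrow> (x \<in> H \<longleftrightarrow> y \<in> H)"
proof -
  note sub = subgroup.subset[OF H]
  have xinv: "y = inv x \<otimes> (x \<otimes> y)" using x y by (simp add: m_assoc[symmetric])
  have yinv: "x = (x \<otimes> y) \<otimes> inv y" using x y by (simp add: m_assoc)
  have "x \<otimes> y \<in> H" if out: "x \<notin> H" "y \<notin> H"
  proof -
    let ?T = "(\<lambda>h. inv x \<otimes> h) ` H"
    have "?T \<subseteq> carrier G - H"
    proof
      fix t assume "t \<in> ?T"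
      then obtain h where h: "h \<in> H" "t = inv x \<otimes> h" by blast
      have hG: "h \<in> carrier G" using h sub by blast
      have "t \<notin> H"
      proof
        assume "t \<in> H"
        then have "h \<otimes> inv t \<in> H" using H h by (simp add: subgroup.m_closed subgroup.m_inv_closed)
        moreover have "h \<otimes> inv t = x" using x hG h(2)
          by (simp add: inv_mult_group m_assoc[symmetric])
        ultimately show False using out by simp
      qed
      then show "t \<in> carrier G - H" using x hG h(2) by simp
    qed
    moreover have "inj_on (\<lambda>h. inv x \<otimes> h) H"
      using inj_on_subset[OF inj_on_cmult[OF inv_closed[OF x]] sub] .
    then have "card ?T = card (carrier G - H)"
      using idx sub fin by (simp add: card_image card_Diff_subset finite_subset order_def)
    ultimately have "?T = carrier G - H" using fin by (simp add: card_subset_eq)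
    then obtain h where "h \<in> H" "y = inv x \<otimes> h" using y out by blast
    moreover from this have "x \<otimes> y = h" using x sub by (auto simp: m_assoc[symmetric])
    ultimately show ?thesis by simp
  qed
  moreover have "y \<in> H" if "x \<in> H" "x \<otimes> y \<in> H"
    using subgroup.m_closed[OF H subgroup.m_inv_closed[OF H that(1)] that(2)] xinv by simp
  moreover have "x \<in> H" if "y \<in> H" "x \<otimes> y \<in> H"
    using subgroup.m_closed[OF H that(2) subgroup.m_inv_closed[OF H that(1)]] yinv by simp
  ultimately show ?thesis using subgroup.m_closed[OF H] by blast
qed

text \<open>
  Meant for subgroups \<open>H\<close> of index two, whose cosets are \<open>H\<close> and its complement.
\<close>

definition preserves_cosets :: "('a, 'b) monoid_scheme \<Rightarrow> 'a set \<Rightarrow> ('a \<Rightarrow> 'a) \<Rightarrow> bool" where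
  "preserves_cosets G H f \<longleftrightarrow>
     (\<forall>x\<in>carrier G. \<forall>y\<in>carrier G. (x \<in> H \<longleftrightarrow> y \<in> H) \<longrightarrow> (f x \<in> H \<longleftrightarrow> f y \<in> H))"

text \<open>
  Here \<open>g\<close> stands for \<open>x \<mapsto> x f(x)\<close> or \<open>x \<mapsto> inv x f(x)\<close>. As a bijection, \<open>f\<close> either fixes both cosets
  or exchanges them. In the first case \<open>x\<close> and \<open>f x\<close> always lie in the same coset and \<open>g\<close> takes
  values only in \<open>H\<close>; in the second case \<open>g\<close> never takes a value in \<open>H\<close>. Either way \<open>g\<close> is
  not onto.
\<close>

lemma (in group) index_two_obstruction:
  assumes H: "subgroup H G" and fin: "finite (carrier G)" and idx: "2 * card H = order G"
    and f: "f permutes carrier G" "preserves_cosets G H f"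
    and g: "g ` carrier G = carrier G"
    and parity: "\<And>x. x \<in> carrier G \<Longrightarrow> g x \<in> H \<longleftrightarrow> (x \<in> H \<longleftrightarrow> f x \<in> H)"
  shows False
proof -
  have one: "\<one> \<in> H" "\<one> \<in> carrier G" using H by (simp_all add: subgroup.one_closed)
  have "carrier G \<noteq> H"
  proof
    assume "carrier G = H"
    then have "card H = 0" using idx by (simp add: order_def)
    then show False using one fin \<open>carrier G = H\<close> by auto
  qed
  then obtain w where w: "w \<in> carrier G" "w \<notin> H" using subgroup.subset[OF H] by blast
  have f_onto: "\<exists>x\<in>carrier G. f x = y" if "y \<in> carrier G" for y
    using permutes_image[OF f(1)] that by (metis imageE)
  have g_onto: "\<exists>x\<in>carrier G. g x = y" if "y \<in> carrier G" for y
    using g that by (metis imageE)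
  have f_values: "f x \<in> H \<longleftrightarrow> (if x \<in> H then f \<one> \<in> H else f w \<in> H)" if x: "x \<in> carrier G" for x
  proof (cases "x \<in> H")
    case True
    then have "f x \<in> H \<longleftrightarrow> f \<one> \<in> H" using f(2) x one unfolding preserves_cosets_def by blast
    then show ?thesis using True by simp
  next
    case False
    then have "f x \<in> H \<longleftrightarrow> f w \<in> H" using f(2) x w unfolding preserves_cosets_def by blast
    then show ?thesis using False by simp
  qed
  obtain u v where uv: "u \<in> carrier G" "f u = \<one>" "v \<in> carrier G" "f v = w"
    using f_onto[OF one(2)] f_onto[OF w(1)] by blast
  have differ: "f \<one> \<in> H \<longleftrightarrow> f w \<notin> H"
    using f_values[OF uv(1)] f_values[OF uv(3)] uv one w by (auto split: if_splits)
  have const: "g x \<in> H \<longleftrightarrow> f \<one> \<in> H" if "x \<in> carrier G" for x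
    using parity[OF that] f_values[OF that] differ by (auto split: if_splits)
  obtain u' v' where uv': "u' \<in> carrier G" "g u' = \<one>" "v' \<in> carrier G" "g v' = w"
    using g_onto[OF one(2)] g_onto[OF w(1)] by blast
  then show False using const[OF uv'(1)] const[OF uv'(3)] one w by simp
qed

section \<open>Large sets of permutations closed under right translations\<close>

definition right_translation :: "('a, 'b) monoid_scheme \<Rightarrow> 'a \<Rightarrow> 'a \<Rightarrow> 'a" where
  "right_translation G h = (\<lambda>x. if x \<in> carrier G then x \<otimes>\<^bsub>G\<^esub> h else x)"

text \<open>
  The argument common to complete mappings and orthomorphisms: if the group \<open>P\<close> generated by \<open>A\<close>
  missed an even permutation, it would be primitive, or have at least three blocks, or have two
  blocks. The number of elements of \<open>A\<close> excludes the first two cases, and the assumption on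
  subgroups of index two excludes the third.
\<close>

theorem (in group) alt_subset_generate_if_many:
  assumes fin: "finite (carrier G)" and large: "280816 \<le> order G"
    and A: "\<And>f. f \<in> A \<Longrightarrow> f permutes carrier G"
    and transl: "\<And>f h. f \<in> A \<Longrightarrow> h \<in> carrier G \<Longrightarrow> right_translation G h \<circ> f \<in> A"
    and no_index_two:
      "\<And>H f. subgroup H G \<Longrightarrow> 2 * card H = order G \<Longrightarrow> f \<in> A \<Longrightarrow> \<not> preserves_cosets G H f"
    and many: "exp (- 12 / 11 * real (order G)) * fact (order G) \<le> real (card A)"
  shows "alt_on (carrier G) \<subseteq> generate (sym_on (carrier G)) A"
proof (rule ccontr)
  let ?S = "carrier G" and ?n = "order G"
  define P where "P = generate (sym_on ?S) A"
  assume "\<not> alt_on ?S \<subseteq> generate (sym_on ?S) A"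
  then have no_alt: "\<not> alt_on ?S \<subseteq> P" by (simp add: P_def)
  have A_carrier: "A \<subseteq> carrier (sym_on ?S)" using A by (auto simp: sym_on_def)
  have P: "subgroup P (sym_on ?S)"
    unfolding P_def using group.generate_is_subgroup[OF group_sym_on A_carrier] .
  note D = subgroup_sym_onD[OF P]
  have AP: "A \<subseteq> P" by (auto simp: P_def intro: generate.incl)
  have finP: "finite P"
    using D(1) by (intro finite_subset[OF _ finite_permutations[OF fin]]) auto
  have card_AP: "card A \<le> card P" using AP finP by (rule card_mono[rotated])
  have "0 < exp (- 12 / 11 * real ?n) * (fact ?n :: real)" by simp
  then have "0 < card A" using many by linarith
  then obtain f where f: "f \<in> A" by (metis card_gt_0_iff ex_in_conv)
  have translP: "right_translation G h \<in> P" if h: "h \<in> ?S" for h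
  proof -
    have "right_translation G h \<circ> f \<in> P" "f \<in> P" using transl[OF f h] f AP by auto
    then have "right_translation G h \<circ> f \<circ> Hilbert_Choice.inv f \<in> P" by (intro D(3)[OF _ D(4)])
    then show ?thesis
      using surj_iff[THEN iffD1, OF permutes_surj[OF A[OF f]]] by (simp add: comp_assoc)
  qed
  have trans: "\<exists>p\<in>P. p x = y" if "x \<in> ?S" "y \<in> ?S" for x y
    using that by (intro bexI[OF _ translP[of "inv x \<otimes> y"]])
      (simp_all add: right_translation_def m_assoc[symmetric])
  show False
  proof (cases "primitive_on ?S P")
    case True
    define h where "h = ?n - ?n div 2"
    have "card P * fact h \<le> (fact ?n :: nat)"
      using bochert_index_bound[OF P fin True no_alt] by (simp add: order_def h_def)
    then have "card A * fact h \<le> (fact ?n :: nat)"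
      using card_AP by (meson mult_le_mono1 order_trans)
    then have "real (card A * fact h) \<le> real (fact ?n)" by (simp only: of_nat_le_iff)
    then have up: "real (card A) * fact h \<le> fact ?n" by simp
    have "fact ?n = exp (- 12 / 11 * real ?n) * fact ?n * exp (12 / 11 * real ?n)"
      by (simp add: exp_minus field_simps)
    also have "\<dots> \<le> real (card A) * exp (12 / 11 * real ?n)"
      using many by (intro mult_right_mono) simp_all
    also have "\<dots> < real (card A) * fact h"
      using half_factorial_large[OF large] \<open>0 < card A\<close> by (simp add: h_def)
    finally show False using up by simp
  next
    case False
    then obtain r where r: "equiv ?S r" and inv: "invariant_under P r"
      and nontriv: "r \<noteq> Id_on ?S" "r \<noteq> ?S \<times> ?S"
      by (auto simp: primitive_on_def)
    \<comment> \<open>The classes of \<open>r\<close> are \<open>k\<close> blocks of size \<open>m\<close>, and \<open>H\<close> is the block of the identity.\<close>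
    define H where "H = r `` {\<one>}"
    define m where "m = card H"
    define k where "k = card (?S // r)"
    have rS: "r \<subseteq> ?S \<times> ?S" using r by (rule equiv_type)
    have shift: "(x \<otimes> z, y \<otimes> z) \<in> r" if "(x, y) \<in> r" "z \<in> ?S" for x y z
    proof -
      have "(right_translation G z x, right_translation G z y) \<in> r"
        using inv translP[OF that(2)] that(1) by (auto simp: invariant_under_def)
      then show ?thesis using that(1) rS by (auto simp: right_translation_def)
    qed
    have block: "H \<in> ?S // r" unfolding H_def by (rule quotientI) simp
    have size: "card B = m" if "B \<in> ?S // r" for B
      unfolding m_def using transitive_block_sizes[OF fin r D(1) inv trans that block] .
    have finQ: "finite (?S // r)" using fin rS by (rule finite_quotient)
    have n_eq: "?n = m * k"
    proof -
      have "m * card (?S // r) = card (\<Union> (?S // r))"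
        using fin size quotient_disj[OF r]
        by (intro card_partition[OF finQ]) (auto simp only: Union_quotient[OF r])
      then show ?thesis by (simp only: Union_quotient[OF r] k_def order_def)
    qed
    have n_pos: "?n > 0" using large by simp
    have "m \<noteq> 1"
    proof
      assume "m = 1"
      have "(x, y) \<in> r \<longleftrightarrow> (x, y) \<in> Id_on ?S" for x y
      proof
        assume xy: "(x, y) \<in> r"
        then have x: "x \<in> ?S" using rS by auto
        have "card (r `` {x}) = 1" using size[OF quotientI[OF x]] \<open>m = 1\<close> by simp
        moreover have "x \<in> r `` {x}" "y \<in> r `` {x}" using xy equiv_class_self[OF r x] by auto
        ultimately have "x = y" by (metis card_1_singletonE singletonD)
        then show "(x, y) \<in> Id_on ?S" using x by auto
      next
        assume "(x, y) \<in> Id_on ?S"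
        then show "(x, y) \<in> r" using equiv_class_self[OF r] by auto
      qed
      then show False using nontriv(1) by auto
    qed
    moreover have "k \<noteq> 1"
    proof
      assume "k = 1"
      then obtain C where C: "?S // r = {C}" unfolding k_def by (auto simp: card_1_singleton_iff)
      have "(x, y) \<in> r" if "x \<in> ?S" "y \<in> ?S" for x y
      proof -
        have "r `` {x} = r `` {y}" using quotientI[OF that(1), of r] quotientI[OF that(2), of r] C by auto
        then show ?thesis using that r by (simp add: eq_equiv_class_iff)
      qed
      then show False using nontriv(2) rS by auto
    qed
    \<comment> \<open>With two blocks, \<open>H\<close> is a subgroup of index two, and being in the same block means agreeing on
      membership in \<open>H\<close>.\<close>
    moreover have "k \<noteq> 2"
    proof
      assume "k = 2"
      then have idx: "2 * card H = ?n" using n_eq by (simp add: m_def)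
      have HS: "H \<subseteq> ?S" using rS by (auto simp: H_def)
      have H: "subgroup H G"
      proof (rule subgroupI)
        show "H \<noteq> {}" using equiv_class_self[OF r one_closed] by (auto simp: H_def)
        show "inv x \<in> H" if "x \<in> H" for x
        proof -
          have x: "(\<one>, x) \<in> r" "x \<in> ?S" using that HS by (auto simp: H_def)
          then have "(inv x, \<one>) \<in> r" using shift[OF x(1), of "inv x"] by simp
          then show ?thesis using r by (auto simp: H_def elim: equivE dest: symD)
        qed
        show "x \<otimes> y \<in> H" if "x \<in> H" "y \<in> H" for x y
        proof -
          have xy: "(\<one>, x) \<in> r" "(\<one>, y) \<in> r" "y \<in> ?S" using that HS by (auto simp: H_def)
          then have "(y, x \<otimes> y) \<in> r" using shift[OF xy(1,3)] by simp
          then show ?thesis using xy(2) r by (auto simp: H_def elim: equivE dest: transD)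
        qed
      qed (rule HS)
      have rH: "(x, y) \<in> r \<longleftrightarrow> (x \<in> H \<longleftrightarrow> y \<in> H)" if xy: "x \<in> ?S" "y \<in> ?S" for x y
      proof -
        have "(x, y) \<in> r \<longleftrightarrow> y \<otimes> inv x \<in> H"
        proof
          assume "(x, y) \<in> r"
          then show "y \<otimes> inv x \<in> H" using shift[of x y "inv x"] xy by (simp add: H_def)
        next
          assume "y \<otimes> inv x \<in> H"
          then show "(x, y) \<in> r" using shift[of \<one> "y \<otimes> inv x" x] xy by (simp add: H_def m_assoc)
        qed
        moreover have "inv x \<in> H \<longleftrightarrow> x \<in> H"
          using subgroup.m_inv_closed[OF H, of x] subgroup.m_inv_closed[OF H, of "inv x"] xy by auto
        ultimately show ?thesis using index_two_mult_iff[OF H fin idx, of y "inv x"] xy by auto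
      qed
      have "preserves_cosets G H f"
        unfolding preserves_cosets_def
      proof (intro ballI impI)
        fix x y assume xy: "x \<in> ?S" "y \<in> ?S" "x \<in> H \<longleftrightarrow> y \<in> H"
        then have "(x, y) \<in> r" using rH[of x y] by simp
        then have "(f x, f y) \<in> r" using inv f AP by (auto simp: invariant_under_def)
        then show "f x \<in> H \<longleftrightarrow> f y \<in> H" using rH[of "f x" "f y"] rS by auto
      qed
      then show False using no_index_two[OF H idx f] by simp
    qed
    moreover have "m \<noteq> 0" "k \<noteq> 0" using n_eq n_pos by auto
    ultimately have mk: "2 \<le> m" "3 \<le> k" by linarith+
    have "A \<subseteq> {p. p permutes ?S \<and> invariant_under {p} r}"
      using A AP inv by (auto simp: invariant_under_def)
    then have "card A \<le> card {p. p permutes ?S \<and> invariant_under {p} r}"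
      using finite_permutations[OF fin] by (intro card_mono) simp_all
    also have "\<dots> \<le> fact k * fact m ^ k"
      unfolding k_def by (rule card_block_preserving_le[OF fin r size])
    finally have "real (card A) \<le> real (fact k * fact m ^ k)" by (simp only: of_nat_le_iff)
    also have "\<dots> = fact k * fact m ^ k" by simp
    also have "\<dots> < exp (- 12 / 11 * real ?n) * fact ?n"
      using block_system_count_small[OF mk] large by (simp add: n_eq)
    finally show False using many by simp
  qed
qed


section \<open>Complete mappings and orthomorphisms\<close>

lemma (in group) right_translation_permutes:
  assumes fin: "finite (carrier G)" and h: "h \<in> carrier G"
  shows "right_translation G h permutes carrier G"
proof (rule inj_imp_permutes)
  show "inj_on (right_translation G h) (carrier G)"
    using h by (auto simp: inj_on_def right_translation_def)
qed (use fin h in \<open>auto simp: right_translation_def\<close>)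

text \<open>
  The permutation \<open>g \<mapsto> g f(g)\<close> changes by the same right translation as \<open>f\<close>.
\<close>

lemma (in group) complete_mapping_translate:
  assumes fin: "finite (carrier G)" and f: "complete_mapping G f" and h: "h \<in> carrier G"
  shows "complete_mapping G (right_translation G h \<circ> f)"
proof -
  note R = right_translation_permutes[OF fin h]
  have f': "f permutes carrier G" "bij_betw (\<lambda>g. g \<otimes> f g) (carrier G) (carrier G)"
    using f by (auto simp: complete_mapping_def)
  have "bij_betw (right_translation G h \<circ> (\<lambda>g. g \<otimes> f g)) (carrier G) (carrier G)"
    using f'(2) permutes_imp_bij[OF R] by (rule bij_betw_trans)
  moreover have "(right_translation G h \<circ> (\<lambda>g. g \<otimes> f g)) g = g \<otimes> (right_translation G h \<circ> f) g"
    if "g \<in> carrier G" for g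
    using that h permutes_in_image[OF f'(1), of g] by (simp add: right_translation_def m_assoc)
  ultimately have "bij_betw (\<lambda>g. g \<otimes> (right_translation G h \<circ> f) g) (carrier G) (carrier G)"
    by (metis (no_types, lifting) bij_betw_cong)
  then show ?thesis using permutes_compose[OF f'(1) R] by (simp add: complete_mapping_def)
qed

lemma (in group) orthomorphism_translate:
  assumes fin: "finite (carrier G)" and f: "orthomorphism G f" and h: "h \<in> carrier G"
  shows "orthomorphism G (right_translation G h \<circ> f)"
proof -
  note R = right_translation_permutes[OF fin h]
  have f': "f permutes carrier G" "bij_betw (\<lambda>g. inv g \<otimes> f g) (carrier G) (carrier G)"
    using f by (auto simp: orthomorphism_def)
  have "bij_betw (right_translation G h \<circ> (\<lambda>g. inv g \<otimes> f g)) (carrier G) (carrier G)"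
    using f'(2) permutes_imp_bij[OF R] by (rule bij_betw_trans)
  moreover have "(right_translation G h \<circ> (\<lambda>g. inv g \<otimes> f g)) g = inv g \<otimes> (right_translation G h \<circ> f) g"
    if "g \<in> carrier G" for g
    using that h permutes_in_image[OF f'(1), of g] by (simp add: right_translation_def m_assoc)
  ultimately have "bij_betw (\<lambda>g. inv g \<otimes> (right_translation G h \<circ> f) g) (carrier G) (carrier G)"
    by (metis (no_types, lifting) bij_betw_cong)
  then show ?thesis using permutes_compose[OF f'(1) R] by (simp add: orthomorphism_def)
qed

lemma (in group) complete_mapping_not_preserves_cosets:
  assumes fin: "finite (carrier G)" and f: "complete_mapping G f"
    and H: "subgroup H G" and idx: "2 * card H = order G"
  shows "\<not> preserves_cosets G H f"
proof
  assume pres: "preserves_cosets G H f"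
  have f': "f permutes carrier G" and onto: "(\<lambda>g. g \<otimes> f g) ` carrier G = carrier G"
    using f by (auto simp: complete_mapping_def bij_betw_def)
  show False
    using index_two_mult_iff[OF H fin idx] permutes_in_image[OF f']
    by (intro index_two_obstruction[OF H fin idx f' pres onto]) simp
qed

lemma (in group) orthomorphism_not_preserves_cosets:
  assumes fin: "finite (carrier G)" and f: "orthomorphism G f"
    and H: "subgroup H G" and idx: "2 * card H = order G"
  shows "\<not> preserves_cosets G H f"
proof
  assume pres: "preserves_cosets G H f"
  have f': "f permutes carrier G" and onto: "(\<lambda>g. inv g \<otimes> f g) ` carrier G = carrier G"
    using f by (auto simp: orthomorphism_def bij_betw_def)
  have "inv x \<in> H \<longleftrightarrow> x \<in> H" if "x \<in> carrier G" for x
    using subgroup.m_inv_closed[OF H, of x] subgroup.m_inv_closed[OF H, of "inv x"] that by auto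
  then show False
    using index_two_mult_iff[OF H fin idx] permutes_in_image[OF f']
    by (intro index_two_obstruction[OF H fin idx f' pres onto]) simp
qed

text \<open>
  If \<open>f\<close> is a complete mapping, \<open>\<theta> g = g f(g)\<close> is an orthomorphism, because
  \<open>inv g \<theta> g = f g\<close> is again a permutation; and \<open>f\<close> can be recovered from \<open>\<theta>\<close>.
\<close>

lemma (in group) card_complete_mappings_le_card_orthomorphisms:
  assumes fin: "finite (carrier G)"
  shows "card {f. complete_mapping G f} \<le> card {f. orthomorphism G f}"
proof (rule card_inj_on_le)
  let ?\<theta> = "\<lambda>f x. if x \<in> carrier G then x \<otimes> f x else x"
  show "inj_on ?\<theta> {f. complete_mapping G f}"
  proof (rule inj_onI, rule ext)
    fix f f' x
    assume "f \<in> {f. complete_mapping G f}" "f' \<in> {f. complete_mapping G f}" and eq: "?\<theta> f = ?\<theta> f'"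
    then have perm: "f permutes carrier G" "f' permutes carrier G"
      by (auto simp: complete_mapping_def)
    show "f x = f' x"
    proof (cases "x \<in> carrier G")
      case True
      then show ?thesis
        using fun_cong[OF eq, of x] permutes_in_image[OF perm(1)] permutes_in_image[OF perm(2)] by simp
    next
      case False
      then show ?thesis using permutes_not_in[OF perm(1)] permutes_not_in[OF perm(2)] by simp
    qed
  qed
  show "?\<theta> ` {f. complete_mapping G f} \<subseteq> {f. orthomorphism G f}"
  proof (rule image_subsetI)
    fix f assume "f \<in> {f. complete_mapping G f}"
    then have f: "f permutes carrier G" "bij_betw (\<lambda>g. g \<otimes> f g) (carrier G) (carrier G)"
      by (auto simp: complete_mapping_def)
    have "bij_betw (?\<theta> f) (carrier G) (carrier G)"
      by (rule bij_betw_cong[THEN iffD1, OF _ f(2)]) simp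
    then have "?\<theta> f permutes carrier G" by (rule bij_imp_permutes) simp
    moreover have "f x = inv x \<otimes> ?\<theta> f x" if "x \<in> carrier G" for x
      using that permutes_in_image[OF f(1)] by (simp add: m_assoc[symmetric])
    then have "bij_betw (\<lambda>x. inv x \<otimes> ?\<theta> f x) (carrier G) (carrier G)"
      by (rule bij_betw_cong[THEN iffD1, OF _ permutes_imp_bij[OF f(1)]])
    ultimately show "?\<theta> f \<in> {f. orthomorphism G f}" by (simp add: orthomorphism_def)
  qed
  show "finite {f. orthomorphism G f}"
    by (rule finite_subset[OF _ finite_permutations[OF fin]]) (auto simp: orthomorphism_def)
qed

lemma (in group) order_quotient_pos:
  assumes "finite (carrier G)"
  shows "order (G Mod H) > 0"
  using assms by (auto simp: order_def FactGroup_def RCOSETS_def card_gt_0_iff)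

theorem theorem1p1p3:
  fixes G (structure) and c :: real
  assumes "0 < c" and "c < exp (- 1 / 2)"
    and "group G" and "finite (carrier G)"
    and "real (card {f. complete_mapping G f})
           \<ge> c * real (order (G Mod derived G (carrier G)))
               * ((fact (order G))\<^sup>2 / real (order G) ^ order G)"
    and "real (order G) \<ge> max 280816 (11 * ln (inverse c))"
  shows "alt_on (carrier G) \<subseteq> P_comp G \<inter> P_orth G"
proof -
  interpret group G by fact
  note fin = \<open>finite (carrier G)\<close>
  have large: "280816 \<le> order G" using assms(6) by simp
  have "exp (- 12 / 11 * real (order G)) * fact (order G)
      \<le> c * real (order (G Mod derived G (carrier G)))
          * ((fact (order G))\<^sup>2 / real (order G) ^ order G)"
    using assms(1,6) large order_quotient_pos[OF fin, of "derived G (carrier G)"]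
    by (intro exp_fact_le_if_count) simp_all
  with assms(5) have comp: "exp (- 12 / 11 * real (order G)) * fact (order G)
      \<le> real (card {f. complete_mapping G f})" by linarith
  with card_complete_mappings_le_card_orthomorphisms[OF fin]
  have orth: "exp (- 12 / 11 * real (order G)) * fact (order G)
      \<le> real (card {f. orthomorphism G f})" by linarith
  have "alt_on (carrier G) \<subseteq> P_comp G"
    unfolding P_comp_def
    using complete_mapping_translate[OF fin] complete_mapping_not_preserves_cosets[OF fin]
    by (intro alt_subset_generate_if_many[OF fin large _ _ _ comp])
       (auto simp: complete_mapping_def[of G])
  moreover have "alt_on (carrier G) \<subseteq> P_orth G"
    unfolding P_orth_def
    using orthomorphism_translate[OF fin] orthomorphism_not_preserves_cosets[OF fin]
    by (intro alt_subset_generate_if_many[OF fin large _ _ _ orth])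
       (auto simp: orthomorphism_def[of G])
  ultimately show ?thesis by simp
qed

end
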